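(* For any $x\in(0,1/2)$ the set $\Lambda(x)=\{\lambda\in(0,1/2]: x\in K_\lambda\}$ is a Lebesgue null set of full Hausdorff dimension (i.e. $\Lambda(x)$ has zero Lebesgue measure and $\dim_H\Lambda(x)=1$). Furthermore, $$\lim_{\delta\to 0^+}\dim_H\big(\Lambda(x)\cap(\lambda-\delta,\lambda+\delta)\big)=\frac{\log 2}{-\log\lambda}\qquad\text{for all }\lambda\in\Lambda(x).$$
   Context: For $\lambda\in(0,1/2]$, $K_\lambda\subset\mathbb{R}$ is the self-similar set generated by the iterated function system $\{f_{\lambda,d}(x)=\lambda x+d(1-\lambda): d=0,1\}$, i.e. the unique nonempty compact set with $K_\lambda=f_{\lambda,0}(K_\lambda)\cup f_{\lambda,1}(K_\lambda)$; equivalently $K_\lambda=\{(1-\lambda)\sum_{n=1}^\infty i_n\lambda^{n-1}: i_n\in\{0,1\}\ \forall n\ge 1\}$. $\dim_H$ denotes Hausdorff dimension. *)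

theory Defs
  imports "HOL-Analysis.Analysis"
begin

section \<open>Hausdorff measure and Hausdorff dimension\<close>

text \<open>
  The cost \<open>(diam U)^s\<close> of a covering set, with the usual conventions that the empty set costs
  nothing and that \<open>0^0 = 1\<close> for a one-point set. They need separate clauses because
  \<open>0 powr 0 = 0\<close>. It is only applied to bounded sets, since \<^const>\<open>diameter\<close> is meaningless
  on unbounded ones.
\<close>

definition diam_power :: "real \<Rightarrow> 'a::metric_space set \<Rightarrow> ennreal" where
  "diam_power s U =
     (if U = {} then 0 else if s = 0 then 1 else ennreal (diameter U powr s))"

definition hausdorff_premeasure :: "real \<Rightarrow> real \<Rightarrow> 'a::metric_space set \<Rightarrow> ennreal" where
  "hausdorff_premeasure s \<delta> A =
     (INF U \<in> {U :: nat \<Rightarrow> 'a set. (\<forall>i. bounded (U i) \<and> diameter (U i) \<le> \<delta>) \<and> A \<subseteq> (\<Union>i. U i)}.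
        \<Sum>i. diam_power s (U i))"

definition hausdorff_measure :: "real \<Rightarrow> 'a::metric_space set \<Rightarrow> ennreal" where
  "hausdorff_measure s A = (SUP \<delta> \<in> {0<..}. hausdorff_premeasure s \<delta> A)"

definition hausdorff_dim :: "'a::metric_space set \<Rightarrow> ereal" where
  "hausdorff_dim A = (INF s \<in> {s. 0 \<le> s \<and> hausdorff_measure s A = 0}. ereal s)"

section \<open>The self-similar sets \<open>K\<^sub>\<lambda>\<close>\<close>

definition ifs_map :: "real \<Rightarrow> nat \<Rightarrow> real \<Rightarrow> real" where
  "ifs_map l d x = l * x + real d * (1 - l)"

definition is_attractor :: "real \<Rightarrow> real set \<Rightarrow> bool" where
  "is_attractor l K \<longleftrightarrow>
     compact K \<and> K \<noteq> {} \<and> K = ifs_map l 0 ` K \<union> ifs_map l 1 ` K"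

definition K_set :: "real \<Rightarrow> real set" where
  "K_set l = (THE K. is_attractor l K)"

definition Lambda_set :: "real \<Rightarrow> real set" where
  "Lambda_set x = {l. 0 < l \<and> l \<le> 1/2 \<and> x \<in> K_set l}"

text \<open>
  The description of \<^const>\<open>K_set\<close> by \<^const>\<open>The\<close> is meaningful: there is exactly one such set,
  and it consists of the expected digit expansions (indexed from \<open>0\<close> here).
\<close>

definition digit_set :: "real \<Rightarrow> real set" where
  "digit_set l = {(1 - l) * (\<Sum>n. real (i n) * l ^ n) | i :: nat \<Rightarrow> nat. \<forall>n. i n \<in> {0, 1}}"

lemma digit_summable:
  fixes i :: "nat \<Rightarrow> nat"
  assumes "0 < l" "l < 1" "\<forall>n. i n \<in> {0, 1}"
  shows "summable (\<lambda>n. real (i n) * l ^ n)"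
proof (rule summable_comparison_test)
  have "norm (real (i n) * l ^ n) \<le> l ^ n" for n
    using spec[OF assms(3), of n] assms(1) by auto
  then show "\<exists>N. \<forall>n\<ge>N. norm (real (i n) * l ^ n) \<le> l ^ n" by blast
  show "summable (\<lambda>n. l ^ n)" using assms by (simp add: summable_geometric)
qed

lemma attractor_eq_digit_set:
  assumes l: "0 < l" "l < 1" and K: "is_attractor l K"
  shows "K = digit_set l"
proof
  have inv: "K = ifs_map l 0 ` K \<union> ifs_map l 1 ` K" and "compact K" and "K \<noteq> {}"
    using K by (auto simp: is_attractor_def)
  then have cl: "closed K" and bd: "bounded K"
    by (auto simp: compact_imp_closed compact_imp_bounded)
  show "K \<subseteq> digit_set l"
  proof
    fix x assume "x \<in> K"
    have "\<forall>y\<in>K. \<exists>p. snd p \<in> K \<and> fst p \<in> {0, 1::nat} \<and> y = ifs_map l (fst p) (snd p)"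
    proof
      fix y assume "y \<in> K"
      then have "y \<in> ifs_map l 0 ` K \<or> y \<in> ifs_map l 1 ` K" using inv by blast
      then obtain d u where "u \<in> K" "d \<in> {0, 1::nat}" "y = ifs_map l d u" by blast
      then show "\<exists>p. snd p \<in> K \<and> fst p \<in> {0, 1::nat} \<and> y = ifs_map l (fst p) (snd p)"
        by (intro exI[of _ "(d, u)"]) simp
    qed
    then obtain g where g: "\<And>y. y \<in> K \<Longrightarrow>
        snd (g y) \<in> K \<and> fst (g y) \<in> {0, 1::nat} \<and> y = ifs_map l (fst (g y)) (snd (g y))"
      by metis
    define z where "z n = ((\<lambda>y. snd (g y)) ^^ n) x" for n
    define i where "i n = fst (g (z n))" for n
    have zK: "z n \<in> K" for n
      by (induction n) (use \<open>x \<in> K\<close> g in \<open>auto simp: z_def\<close>)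
    have i01: "\<forall>n. i n \<in> {0, 1}" using g zK by (simp add: i_def)
    have step: "z n = l * z (Suc n) + real (i n) * (1 - l)" for n
      using g[OF zK[of n]] by (simp add: ifs_map_def i_def z_def)
    have part: "x = (1 - l) * (\<Sum>n<N. real (i n) * l ^ n) + l ^ N * z N" for N
    proof (induction N)
      case 0 show ?case by (simp add: z_def)
    next
      case (Suc N) then show ?case by (simp add: step[of N] algebra_simps)
    qed
    obtain B where B: "\<And>y. y \<in> K \<Longrightarrow> norm y \<le> B" using bd by (auto simp: bounded_iff)
    have "(\<lambda>N. l ^ N * B) \<longlonglongrightarrow> 0 * B"
      using l by (intro tendsto_intros LIMSEQ_power_zero) auto
    then have lim0: "(\<lambda>N. l ^ N * B) \<longlonglongrightarrow> 0" by simp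
    have "norm (l ^ N * z N) \<le> l ^ N * B" for N
      unfolding norm_mult using l by (intro mult_mono B zK) simp_all
    then have rest: "(\<lambda>N. l ^ N * z N) \<longlonglongrightarrow> 0"
      by (intro Lim_null_comparison[OF _ lim0] always_eventually allI)
    have "(\<lambda>N. (1 - l) * (\<Sum>n<N. real (i n) * l ^ n) + l ^ N * z N)
        \<longlonglongrightarrow> (1 - l) * (\<Sum>n. real (i n) * l ^ n) + 0"
      by (intro tendsto_intros rest summable_LIMSEQ digit_summable l i01)
    then have "x = (1 - l) * (\<Sum>n. real (i n) * l ^ n)"
      using part by (simp add: LIMSEQ_const_iff)
    then show "x \<in> digit_set l" using i01 by (auto simp: digit_set_def)
  qed
  show "digit_set l \<subseteq> K"
  proof
    fix x assume "x \<in> digit_set l"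
    then obtain i :: "nat \<Rightarrow> nat" where i01: "\<forall>n. i n \<in> {0, 1}"
      and x: "x = (1 - l) * (\<Sum>n. real (i n) * l ^ n)" by (auto simp: digit_set_def)
    obtain k where "k \<in> K" using \<open>K \<noteq> {}\<close> by blast
    have cld: "l * y + real d * (1 - l) \<in> K" if "y \<in> K" "d \<in> {0, 1}" for y d
    proof -
      have "ifs_map l d y \<in> K" using that by (subst inv) auto
      then show ?thesis by (simp add: ifs_map_def)
    qed
    have mem: "(1 - l) * (\<Sum>n<N. real (i n) * l ^ n) + l ^ N * y \<in> K" if "y \<in> K" for N y
      using that
    proof (induction N arbitrary: y)
      case 0 then show ?case by simp
    next
      case (Suc N)
      show ?case using Suc.IH[OF cld[OF Suc.prems, of "i N"]] i01 by (simp add: algebra_simps)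
    qed
    have "(\<lambda>N. (1 - l) * (\<Sum>n<N. real (i n) * l ^ n) + l ^ N * k)
        \<longlonglongrightarrow> (1 - l) * (\<Sum>n. real (i n) * l ^ n) + 0 * k"
      using l by (intro tendsto_intros summable_LIMSEQ digit_summable i01 LIMSEQ_power_zero) auto
    from closed_sequentially[OF cl mem[OF \<open>k \<in> K\<close>] this]
    show "x \<in> K" by (simp add: x)
  qed
qed

lemma attractor_exists:
  assumes l: "0 < l" "l < 1"
  shows "\<exists>K. is_attractor l K"
proof -
  define F where "F A = ifs_map l 0 ` A \<union> ifs_map l 1 ` A" for A
  define C where "C n = (F ^^ n) {0..1}" for n
  have mono: "F A \<subseteq> F B" if "A \<subseteq> B" for A B using that by (auto simp: F_def)
  have C_Suc: "C (Suc n) = F (C n)" for n by (simp add: C_def)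
  have comp: "compact (C n)" for n
    by (induction n) (auto simp: C_def F_def ifs_map_def
        intro!: compact_Un compact_continuous_image continuous_intros)
  have zero: "0 \<in> C n" for n
    by (induction n) (auto simp: C_def F_def ifs_map_def image_iff)
  have dec1: "C (Suc n) \<subseteq> C n" for n
  proof (induction n)
    case 0
    have "l * y + (1 - l) \<le> 1" "l * y \<le> 1" if "y \<le> 1" for y
      using l mult_left_mono[OF that, of l] by linarith+
    moreover have "0 \<le> l * y" if "0 \<le> y" for y using that l by simp
    ultimately have "ifs_map l d y \<in> {0..1}" if "y \<in> {0..1}" "d = 0 \<or> d = 1" for y d
      using that l by (fastforce simp: ifs_map_def)
    then show ?case by (simp add: C_def F_def image_subset_iff)
  next
    case (Suc n) then show ?case using mono[OF Suc] by (simp add: C_Suc)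
  qed
  have dec: "C n \<subseteq> C m" if "m \<le> n" for m n
    by (rule lift_Suc_antimono_le[of C, OF dec1 that])
  define K where "K = (\<Inter>n. C n)"
  have "compact K" unfolding K_def by (intro compact_Inter) (use comp in auto)
  moreover have "0 \<in> K" using zero by (auto simp: K_def)
  moreover have "F K \<subseteq> K"
  proof -
    have "F K \<subseteq> C n" for n
      using mono[of K "C n"] dec1[of n] by (auto simp: C_Suc K_def)
    then show ?thesis by (auto simp: K_def)
  qed
  moreover have "K \<subseteq> F K"
  proof
    fix y assume y: "y \<in> K"
    define p where "p d = (y - real d * (1 - l)) / l" for d :: nat
    have p: "ifs_map l d u = y \<longleftrightarrow> u = p d" for d u
      using l by (auto simp: p_def ifs_map_def field_simps)
    have "p 0 \<in> C n \<or> p 1 \<in> C n" for n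
    proof -
      have "y \<in> F (C n)" using y C_Suc[of n] by (auto simp: K_def)
      then obtain d u where "u \<in> C n" "d = 0 \<or> d = 1" "ifs_map l d u = y"
        unfolding F_def by blast
      then show ?thesis using p[of d u] by auto
    qed
    then have "(\<forall>n. p 0 \<in> C n) \<or> (\<forall>n. p 1 \<in> C n)"
      by (meson dec linorder_linear subsetD)
    then have "p 0 \<in> K \<or> p 1 \<in> K" by (auto simp: K_def)
    then show "y \<in> F K" unfolding F_def using p[of 0 "p 0"] p[of 1 "p 1"] by (metis UnI1 UnI2 imageI)
  qed
  ultimately show ?thesis by (auto simp: is_attractor_def F_def intro!: exI[of _ K])
qed

lemma K_set_attractor:
  assumes "0 < l" "l < 1"
  shows "is_attractor l (K_set l)"
  unfolding K_set_def
  by (rule theI') (metis attractor_exists attractor_eq_digit_set assms)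

lemma K_set_eq_digit_set:
  assumes "0 < l" "l < 1"
  shows "K_set l = digit_set l"
  using attractor_eq_digit_set[OF assms K_set_attractor[OF assms]] .

end

theory Submission
  imports Defs
begin

text \<open>
  Write \<open>\<pi>\<^sub>\<lambda>(j) = (1 - \<lambda>) \<Sum>\<^sub>n j\<^sub>n \<lambda>\<^sup>n\<close> for the value of a binary sequence \<open>j\<close>, indexed from \<open>0\<close>.
  Then \<open>\<lambda> \<in> \<Lambda>(x)\<close> means that \<open>x = \<pi>\<^sub>\<lambda>(j)\<close> for some \<open>j\<close>, called a coding of \<open>x\<close> at \<open>\<lambda>\<close>. Since
  \<open>x < 1/2\<close>, a coding starts with \<open>0\<close>, and \<open>x \<le> \<lambda>\<close>. Everything rests on how
  \<open>\<pi>\<^sub>\<lambda>(j)\<close> depends on its two arguments.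

  In \<open>j\<close>, for fixed \<open>\<lambda> < 1/2\<close>: two sequences that first differ at place \<open>n\<close> have values at distance
  at most \<open>\<lambda>\<^sup>n\<close> and at least \<open>(1 - 2\<lambda>) \<lambda>\<^sup>n\<close> (\<open>digit_value_agree\<close>, \<open>digit_value_gap\<close>).
  In \<open>\<lambda> \<in> (0, 1/2]\<close>, for fixed \<open>j\<close> with \<open>j\<^sub>0 = 0\<close>: the value is increasing and \<open>1\<close>-Lipschitz, and away
  from \<open>0\<close> and \<open>1/2\<close> it increases at a speed bounded below, uniformly over the sequences that code
  \<open>x\<close> (\<open>digit_value_increment\<close>, \<open>digit_value_increment_uniform\<close>). Hence two parameters
  of \<open>\<Lambda>(x)\<close> in a compact part of \<open>(0, 1/2)\<close> whose codings first differ at place \<open>n\<close> are,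
  up to constant factors, at most \<open>b\<^sup>n\<close> and at least \<open>a\<^sup>n\<close> apart, where \<open>a\<close> and \<open>b\<close> bound both parameters
  from below and from above. So \<open>\<Lambda>(x)\<close> near \<open>\<lambda>\<close> looks like \<open>K\<^sub>\<lambda>\<close> itself, whose dimension
  is \<open>ln 2 / - ln \<lambda>\<close>.

  Upper bound: the prefixes of length \<open>N\<close> of the codings split \<open>\<Lambda>(x) \<inter> (0, b]\<close>, where \<open>b < 1/2\<close>,
  into \<open>2\<^sup>N\<close> pieces of diameter
  \<open>O(b\<^sup>N)\<close>, so the dimension is at most \<open>ln 2 / - ln b\<close>. This is below \<open>1\<close>, and
  \<open>\<Lambda>(x)\<close> is null as a countable union of null sets and one point.

  Lower bound: reading a coding as a binary expansion gives a map from \<open>\<Lambda>(x) \<inter> (a, b)\<close> to \<open>[0, 1]\<close>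
  that is Hoelder continuous with exponent \<open>ln 2 / - ln a\<close>. Every sequence that agrees long enough with a coding
  at a parameter in \<open>(a, b)\<close> is itself a coding at some parameter in \<open>(a, b)\<close>, by the intermediate value
  theorem; so the image contains an interval. As a Hoelder map sends sets of Hausdorff measure zero
  to Lebesgue null sets (\<open>Hoelder_image_null\<close>), the dimension is at least \<open>ln 2 / - ln a\<close>.

  At \<open>\<lambda> = 1/2\<close> the gap \<open>1 - 2\<lambda>\<close> closes. There the upper bound is the dimension of the line, and
  the lower bound is inherited from parameters of \<open>\<Lambda>(x)\<close> just below \<open>1/2\<close>
  (\<open>Lambda_set_accumulates_at_half\<close>). Full dimension is the case \<open>\<lambda> = 1/2\<close> of the limit.
\<close>

section \<open>Hausdorff measure and dimension\<close>

lemma hausdorff_premeasure_le: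
  assumes "\<And>i. bounded (U i)" "\<And>i. diameter (U i) \<le> \<delta>" "A \<subseteq> (\<Union>i. U i)"
  shows "hausdorff_premeasure s \<delta> A \<le> (\<Sum>i. diam_power s (U i))"
  unfolding hausdorff_premeasure_def by (rule INF_lower) (use assms in simp)

lemma hausdorff_premeasure_antimono:
  assumes "\<delta> \<le> \<epsilon>"
  shows "hausdorff_premeasure s \<epsilon> A \<le> hausdorff_premeasure s \<delta> A"
  unfolding hausdorff_premeasure_def
  by (rule INF_superset_mono) (use assms in \<open>auto intro: order_trans\<close>)

lemma hausdorff_measure_eq_0_iff:
  "hausdorff_measure s A = 0 \<longleftrightarrow> (\<forall>\<delta>>0. hausdorff_premeasure s \<delta> A = 0)"
proof
  assume 0: "hausdorff_measure s A = 0"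
  show "\<forall>\<delta>>0. hausdorff_premeasure s \<delta> A = 0"
  proof (intro allI impI)
    fix \<delta> :: real assume "0 < \<delta>"
    then have "hausdorff_premeasure s \<delta> A \<le> hausdorff_measure s A"
      unfolding hausdorff_measure_def by (intro SUP_upper) simp
    then show "hausdorff_premeasure s \<delta> A = 0" using 0 by simp
  qed
next
  assume "\<forall>\<delta>>0. hausdorff_premeasure s \<delta> A = 0"
  then have "hausdorff_measure s A \<le> 0"
    unfolding hausdorff_measure_def by (intro SUP_least) simp
  then show "hausdorff_measure s A = 0" by simp
qed

lemma hausdorff_measure_mono:
  assumes "A \<subseteq> B"
  shows "hausdorff_measure s A \<le> hausdorff_measure s B"
  unfolding hausdorff_measure_def hausdorff_premeasure_def
  by (rule SUP_mono', rule INF_superset_mono) (use assms in auto)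

text \<open>
  Raising the exponent lowers the cost of sets of diameter at most \<open>1\<close>. As the premeasure grows when
  the mesh \<open>\<delta>\<close> shrinks, meshes below \<open>1\<close> suffice.
\<close>

lemma hausdorff_measure_eq_0_mono:
  assumes "hausdorff_measure t A = 0" "0 \<le> t" "t \<le> s"
  shows "hausdorff_measure s A = 0"
  unfolding hausdorff_measure_eq_0_iff
proof (intro allI impI)
  fix \<delta> :: real assume "0 < \<delta>"
  have cost: "diam_power s U \<le> diam_power t U" if U: "bounded U" "diameter U \<le> 1" for U :: "'a set"
  proof -
    have "diameter U powr s \<le> diameter U powr t" if "t \<noteq> 0"
      using assms that U by (cases "diameter U = 0") (auto intro!: powr_mono' diameter_ge_0)
    moreover have "diameter U powr s \<le> 1"
      using assms U diameter_ge_0[OF U(1)] by (intro powr_le1) auto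
    ultimately show ?thesis
      using assms by (auto simp: diam_power_def intro!: ennreal_leI)
  qed
  have "hausdorff_premeasure s \<delta> A \<le> hausdorff_premeasure s (min \<delta> 1) A"
    by (rule hausdorff_premeasure_antimono) simp
  also have "\<dots> \<le> hausdorff_premeasure t (min \<delta> 1) A"
    unfolding hausdorff_premeasure_def
    by (rule INF_mono, rule bexI) (use cost in \<open>auto intro!: suminf_le\<close>)
  also have "\<dots> = 0" using assms(1) \<open>0 < \<delta>\<close> by (simp add: hausdorff_measure_eq_0_iff)
  finally show "hausdorff_premeasure s \<delta> A = 0" by simp
qed

lemma hausdorff_dim_le:
  assumes "0 \<le> s" "hausdorff_measure s A = 0"
  shows "hausdorff_dim A \<le> ereal s"
  unfolding hausdorff_dim_def by (rule INF_lower) (use assms in simp)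

lemma hausdorff_dim_ge:
  assumes "hausdorff_measure s A \<noteq> 0"
  shows "ereal s \<le> hausdorff_dim A"
  unfolding hausdorff_dim_def
proof (rule INF_greatest)
  fix t assume "t \<in> {t. 0 \<le> t \<and> hausdorff_measure t A = 0}"
  then show "ereal s \<le> ereal t"
    using hausdorff_measure_eq_0_mono[of t A s] assms by fastforce
qed

lemma hausdorff_dim_mono:
  assumes "A \<subseteq> B"
  shows "hausdorff_dim A \<le> hausdorff_dim B"
  unfolding hausdorff_dim_def
proof (rule INF_superset_mono)
  show "{s. 0 \<le> s \<and> hausdorff_measure s B = 0} \<subseteq> {s. 0 \<le> s \<and> hausdorff_measure s A = 0}"
    using hausdorff_measure_mono[OF assms] by (auto dest: order_trans) (metis le_zero_eq)
qed simp

text \<open>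
  The covers that come from binary words of length \<open>N\<close>, one set for each word. They show that the
  box dimension of \<open>A\<close> is at most \<open>ln 2 / - ln r\<close>.
\<close>

definition geometric_cover :: "'a::metric_space set \<Rightarrow> real \<Rightarrow> real \<Rightarrow> bool" where
  "geometric_cover A C r \<longleftrightarrow> (\<forall>N. \<exists>\<U>. finite \<U> \<and> card \<U> \<le> 2 ^ N \<and> A \<subseteq> \<Union>\<U> \<and>
     (\<forall>U\<in>\<U>. bounded U \<and> diameter U \<le> C * r ^ N))"

lemma geometric_coverI:
  assumes "\<And>N. finite (\<U> N)" "\<And>N. card (\<U> N) \<le> 2 ^ N" "\<And>N. A \<subseteq> \<Union>(\<U> N)"
    and "\<And>N U. U \<in> \<U> N \<Longrightarrow> bounded U" "\<And>N U. U \<in> \<U> N \<Longrightarrow> diameter U \<le> C * r ^ N"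
  shows "geometric_cover A C r"
  unfolding geometric_cover_def
proof
  fix N
  show "\<exists>\<V>. finite \<V> \<and> card \<V> \<le> 2 ^ N \<and> A \<subseteq> \<Union>\<V> \<and>
      (\<forall>V\<in>\<V>. bounded V \<and> diameter V \<le> C * r ^ N)"
  proof (rule exI[of _ "\<U> N"], intro conjI ballI)
    show "finite (\<U> N)" "card (\<U> N) \<le> 2 ^ N" "A \<subseteq> \<Union>(\<U> N)" by (rule assms)+
    fix V assume V: "V \<in> \<U> N"
    show "bounded V" by (rule assms(4)[OF V])
    show "diameter V \<le> C * r ^ N" by (rule assms(5)[OF V])
  qed
qed

text \<open>
  The \<open>N\<close>-th cover costs at most \<open>2\<^sup>N (C r\<^sup>N)\<^sup>s = C\<^sup>s (2 r\<^sup>s)\<^sup>N\<close>, and the hypothesis on \<open>s\<close> says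
  that \<open>2 r\<^sup>s < 1\<close>.
\<close>

lemma hausdorff_measure_eq_0_if_geometric_cover:
  fixes A :: "'a::metric_space set"
  assumes r: "0 < r" "r < 1" and C: "0 \<le> C" and s: "ln 2 / - ln r < s"
    and cover: "geometric_cover A C r"
  shows "hausdorff_measure s A = 0"
  unfolding hausdorff_measure_eq_0_iff
proof (intro allI impI)
  fix \<delta> :: real assume \<delta>: "0 < \<delta>"
  have "0 < ln 2 / - ln r" using r by (intro divide_pos_pos) auto
  then have s0: "0 < s" using s by linarith
  define q where "q = 2 * r powr s"
  have "ln 2 < s * (- ln r)" using s r by (subst (asm) pos_divide_less_eq) auto
  then have "exp (ln 2 + s * ln r) < exp 0" by (subst exp_less_cancel_iff) simp
  then have q: "0 \<le> q" "q < 1" using r by (auto simp: q_def powr_def exp_add)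
  have bound: "hausdorff_premeasure s \<delta> A \<le> ennreal (C powr s * q ^ N)" if N: "C * r ^ N \<le> \<delta>" for N
  proof -
    obtain \<U> where \<U>: "finite \<U>" "card \<U> \<le> 2 ^ N" "A \<subseteq> \<Union>\<U>"
      "\<And>U. U \<in> \<U> \<Longrightarrow> bounded U" "\<And>U. U \<in> \<U> \<Longrightarrow> diameter U \<le> C * r ^ N"
      using spec[OF cover[unfolded geometric_cover_def], of N] by blast
    obtain h where h: "bij_betw h {0..<card \<U>} \<U>"
      using ex_bij_betw_nat_finite[OF \<U>(1)] by blast
    define U where "U i = (if i < card \<U> then h i else {})" for i
    have hU: "h i \<in> \<U>" if "i < card \<U>" for i using h that by (auto simp: bij_betw_def)
    have "A \<subseteq> (\<Union>i. U i)"
    proof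
      fix a assume "a \<in> A"
      then obtain V where V: "V \<in> \<U>" "a \<in> V" using \<U>(3) by blast
      then have "V \<in> h ` {0..<card \<U>}" using bij_betw_imp_surj_on[OF h] by simp
      then obtain i where "i < card \<U>" "V = h i" by auto
      then show "a \<in> (\<Union>i. U i)" using V by (auto simp: U_def intro!: exI[of _ i])
    qed
    then have "hausdorff_premeasure s \<delta> A \<le> (\<Sum>i. diam_power s (U i))"
    proof (rule hausdorff_premeasure_le[rotated 2])
      show "bounded (U i)" "diameter (U i) \<le> \<delta>" for i
        using hU[of i] \<U>(4,5) N \<delta> by (auto simp: U_def diameter_empty intro: order_trans)
    qed
    also have "\<dots> = (\<Sum>i<card \<U>. diam_power s (U i))"
      by (rule suminf_finite) (auto simp: U_def diam_power_def)
    also have "\<dots> \<le> (\<Sum>i<card \<U>. ennreal (C powr s * (r powr s) ^ N))"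
    proof (rule sum_mono)
      fix i assume i: "i \<in> {..<card \<U>}"
      have "diameter (h i) powr s \<le> (C * r ^ N) powr s"
        using i hU[of i] \<U>(4,5) s0 by (intro powr_mono2) (auto intro: diameter_ge_0)
      also have "\<dots> = C powr s * (r powr s) ^ N"
        using C r by (simp add: powr_mult powr_powr mult.commute flip: powr_realpow)
      finally show "diam_power s (U i) \<le> ennreal (C powr s * (r powr s) ^ N)"
        using i s0 by (auto simp: U_def diam_power_def intro!: ennreal_leI)
    qed
    also have "\<dots> = ennreal (real (card \<U>) * (C powr s * (r powr s) ^ N))"
      by (simp add: ennreal_mult'' ennreal_of_nat_eq_real_of_nat)
    also have "\<dots> \<le> ennreal (2 ^ N * (C powr s * (r powr s) ^ N))"
    proof (intro ennreal_leI mult_right_mono)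
      show "real (card \<U>) \<le> 2 ^ N" using \<U>(2) by (metis of_nat_le_iff of_nat_numeral of_nat_power)
    qed simp
    finally show ?thesis by (simp add: q_def power_mult_distrib mult_ac)
  qed
  have "(\<lambda>N. C * r ^ N) \<longlonglongrightarrow> C * 0" using r by (intro tendsto_intros LIMSEQ_power_zero) auto
  then have "eventually (\<lambda>N. C * r ^ N < \<delta>) sequentially" using \<delta> by (auto dest: order_tendstoD)
  then have ev: "eventually (\<lambda>N. hausdorff_premeasure s \<delta> A \<le> ennreal (C powr s * q ^ N)) sequentially"
    by (rule eventually_mono) (use bound in auto)
  have "(\<lambda>N. ennreal (C powr s * q ^ N)) \<longlonglongrightarrow> ennreal (C powr s * 0)"
    using q by (intro tendsto_intros tendsto_ennrealI LIMSEQ_power_zero) auto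
  from tendsto_lowerbound[OF this ev] show "hausdorff_premeasure s \<delta> A = 0" by simp
qed

lemma hausdorff_dim_le_if_geometric_cover:
  fixes A :: "'a::metric_space set"
  assumes r: "0 < r" "r < 1" and C: "0 \<le> C"
    and cover: "geometric_cover A C r"
  shows "hausdorff_dim A \<le> ereal (ln 2 / - ln r)"
proof (rule ereal_le_epsilon2)
  fix e :: real assume e: "0 < e"
  have "0 < ln 2 / - ln r" using r by (intro divide_pos_pos) auto
  then show "hausdorff_dim A \<le> ereal (ln 2 / - ln r) + ereal e"
    using hausdorff_dim_le[OF _ hausdorff_measure_eq_0_if_geometric_cover[OF r C _ cover]] e by simp
qed

text \<open>
  A set of diameter \<open>d\<close> is mapped into an interval of length \<open>2 C d\<^sup>s\<close>, so the cost of a cover of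
  \<open>A\<close> bounds the outer measure of the image up to the factor \<open>2 C\<close>. With the identity for \<open>h\<close> and
  \<open>s = 1\<close> this compares Hausdorff and Lebesgue measure on the line; applied to a map onto a set that
  contains an interval, it bounds a dimension from below.
\<close>

lemma Hoelder_image_null:
  fixes h :: "'a::metric_space \<Rightarrow> real"
  assumes s: "0 < s" and C: "0 \<le> C" and A: "hausdorff_measure s A = 0"
    and hoelder: "\<And>u v. u \<in> A \<Longrightarrow> v \<in> A \<Longrightarrow> \<bar>h u - h v\<bar> \<le> C * dist u v powr s"
  shows "h ` A \<in> null_sets lebesgue"
  unfolding negligible_iff_null_sets[symmetric] negligible_outer_le
proof (intro allI impI)
  fix e :: real assume e: "0 < e"
  \<comment> \<open>The summand \<open>1\<close> keeps the divisor positive when \<open>C = 0\<close>.\<close>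
  define e' where "e' = e / (2 * C + 1)"
  have e': "0 < e'" "2 * C * e' \<le> e" using e C by (auto simp: e'_def field_simps)
  have "hausdorff_premeasure s 1 A < ennreal e'"
    using A e' by (simp add: hausdorff_measure_eq_0_iff)
  then obtain U where U: "\<And>i. bounded (U i)" "A \<subseteq> (\<Union>i. U i)"
    and lt: "(\<Sum>i. diam_power s (U i)) < ennreal e'"
    unfolding hausdorff_premeasure_def INF_less_iff by auto
  define p where "p i = (SOME u. u \<in> A \<inter> U i)" for i
  define d where "d i = (if A \<inter> U i = {} then 0 else diameter (U i) powr s)" for i
  define V where "V i = {h (p i) - C * d i .. h (p i) + C * d i}" for i
  have d: "0 \<le> d i" for i by (simp add: d_def)
  have p: "p i \<in> A \<inter> U i" if "A \<inter> U i \<noteq> {}" for i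
    using that some_in_eq[of "A \<inter> U i"] unfolding p_def by blast
  have "h ` A \<subseteq> (\<Union>i. V i)"
  proof
    fix y assume "y \<in> h ` A"
    then obtain u i where u: "u \<in> A" "u \<in> U i" "y = h u" using U(2) by blast
    then have pi: "p i \<in> A" "p i \<in> U i" using p by auto
    have "dist u (p i) powr s \<le> diameter (U i) powr s"
      using s diameter_bounded_bound[OF U(1) u(2) pi(2)] by (intro powr_mono2) auto
    then have "\<bar>y - h (p i)\<bar> \<le> C * d i"
      using hoelder[OF u(1) pi(1)] u C by (auto simp: d_def intro: order_trans mult_left_mono)
    then show "y \<in> (\<Union>i. V i)" by (auto simp: V_def abs_le_iff intro!: exI[of _ i])
  qed
  moreover have le: "emeasure lebesgue (\<Union>i. V i) \<le> ennreal e"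
  proof -
    have "emeasure lebesgue (\<Union>i. V i) \<le> (\<Sum>i. emeasure lebesgue (V i))"
      by (rule emeasure_subadditive_countably) (auto simp: V_def)
    also have "\<dots> = (\<Sum>i. ennreal (2 * C) * ennreal (d i))"
      using C d by (simp add: V_def mult.assoc flip: ennreal_mult)
    also have "\<dots> = ennreal (2 * C) * (\<Sum>i. ennreal (d i))"
      by (rule ennreal_suminf_cmult)
    also have "\<dots> \<le> ennreal (2 * C) * (\<Sum>i. diam_power s (U i))"
      using s by (intro mult_left_mono suminf_le) (auto simp: d_def diam_power_def)
    also have "\<dots> \<le> ennreal (2 * C) * ennreal e'"
      using lt by (intro mult_left_mono) auto
    also have "\<dots> = ennreal (2 * C * e')" using C e' by (simp add: ennreal_mult)
    also have "\<dots> \<le> ennreal e" using e' by (intro ennreal_leI)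
    finally show ?thesis .
  qed
  moreover have "(\<Union>i. V i) \<in> lmeasurable"
    by (rule fmeasurableI) (use le in \<open>auto simp: V_def intro: le_less_trans\<close>)
  moreover have "measure lebesgue (\<Union>i. V i) \<le> e"
    using le e by (simp add: measure_def enn2real_leI)
  ultimately show "\<exists>T. h ` A \<subseteq> T \<and> T \<in> lmeasurable \<and> measure lebesgue T \<le> e" by blast
qed

section \<open>Values of binary sequences and codings of a point\<close>

definition binary_seq :: "(nat \<Rightarrow> nat) \<Rightarrow> bool" where
  "binary_seq j \<longleftrightarrow> (\<forall>n. j n \<in> {0, 1})"

definition digit_value :: "real \<Rightarrow> (nat \<Rightarrow> nat) \<Rightarrow> real" where
  "digit_value l j = (1 - l) * (\<Sum>n. real (j n) * l ^ n)"

lemma binary_seq_shift: "binary_seq j \<Longrightarrow> binary_seq (\<lambda>n. j (n + N))"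
  by (simp add: binary_seq_def)

lemma digit_value_sums:
  assumes "0 < l" "l < 1" "binary_seq j"
  shows "(\<lambda>n. real (j n) * (l ^ n * (1 - l))) sums digit_value l j"
proof -
  have "summable (\<lambda>n. real (j n) * l ^ n)"
    using assms by (intro digit_summable) (auto simp: binary_seq_def)
  from sums_mult[OF summable_sums[OF this], of "1 - l"] show ?thesis
    by (simp add: digit_value_def mult_ac)
qed

lemma digit_value_split:
  assumes "0 < l" "l < 1" "binary_seq j"
  shows "digit_value l j =
    (1 - l) * (\<Sum>n<N. real (j n) * l ^ n) + l ^ N * digit_value l (\<lambda>n. j (n + N))"
proof -
  have s: "summable (\<lambda>n. real (j n) * l ^ n)"
    using assms by (intro digit_summable) (auto simp: binary_seq_def)
  have s': "summable (\<lambda>n. real (j (n + N)) * l ^ n)"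
    using assms by (intro digit_summable) (auto simp: binary_seq_def)
  have "(\<Sum>n. real (j (n + N)) * l ^ (n + N)) = l ^ N * (\<Sum>n. real (j (n + N)) * l ^ n)"
    using suminf_mult[OF s', of "l ^ N"] by (simp add: power_add mult_ac)
  then show ?thesis
    unfolding digit_value_def suminf_split_initial_segment[OF s, of N]
    by (simp add: algebra_simps)
qed

lemma digit_value_all_ones: "0 < l \<Longrightarrow> l < 1 \<Longrightarrow> digit_value l (\<lambda>_. 1) = 1"
  by (simp add: digit_value_def suminf_geometric)

lemma digit_value_bounds:
  assumes "0 < l" "l < 1" "binary_seq j"
  shows "0 \<le> digit_value l j" "digit_value l j \<le> 1"
proof -
  have j: "real (j n) \<le> 1" for n
    using assms(3)[unfolded binary_seq_def, rule_format, of n] by auto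
  show "0 \<le> digit_value l j"
    by (rule sums_le[OF _ sums_zero digit_value_sums[OF assms]]) (use assms in simp)
  have one: "(\<lambda>n. real 1 * (l ^ n * (1 - l))) sums 1"
    using digit_value_sums[OF assms(1,2), of "\<lambda>_. 1"] digit_value_all_ones[OF assms(1,2)]
    by (simp add: binary_seq_def)
  show "digit_value l j \<le> 1"
    by (rule sums_le[OF _ digit_value_sums[OF assms] one], rule mult_right_mono)
       (use assms j in auto)
qed

lemma digit_value_agree:
  assumes l: "0 < l" "l < 1" and j: "binary_seq j" "binary_seq k"
    and eq: "\<And>n. n < N \<Longrightarrow> j n = k n"
  shows "\<bar>digit_value l j - digit_value l k\<bar> \<le> l ^ N"
proof -
  let ?J = "digit_value l (\<lambda>n. j (n + N))" and ?K = "digit_value l (\<lambda>n. k (n + N))"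
  have "(\<Sum>n<N. real (j n) * l ^ n) = (\<Sum>n<N. real (k n) * l ^ n)"
    using eq by (intro sum.cong) auto
  then have "digit_value l j - digit_value l k = l ^ N * (?J - ?K)"
    using digit_value_split[OF l j(1), of N] digit_value_split[OF l j(2), of N]
    by (simp add: algebra_simps)
  moreover have "\<bar>?J - ?K\<bar> \<le> 1"
    using digit_value_bounds[OF l binary_seq_shift[OF j(1)], of N]
      digit_value_bounds[OF l binary_seq_shift[OF j(2)], of N] by (simp add: abs_le_iff)
  ultimately show ?thesis
    using l by (simp add: abs_mult mult_left_le)
qed

lemma digit_value_first_digit:
  assumes l: "0 < l" "l < 1" and j: "binary_seq j"
  shows "j 0 = 0 \<Longrightarrow> digit_value l j \<le> l" "j 0 \<noteq> 0 \<Longrightarrow> 1 - l \<le> digit_value l j"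
proof -
  have s: "digit_value l j = (1 - l) * real (j 0) + l * digit_value l (\<lambda>n. j (n + 1))"
    using digit_value_split[OF l j, of 1] by simp
  note b = digit_value_bounds[OF l binary_seq_shift[OF j], of 1]
  show "j 0 = 0 \<Longrightarrow> digit_value l j \<le> l" using s b l by (simp add: mult_left_le)
  have "j 0 = 0 \<or> j 0 = 1" using j by (auto simp: binary_seq_def)
  then show "j 0 \<noteq> 0 \<Longrightarrow> 1 - l \<le> digit_value l j" using s b l by auto
qed

text \<open>
  Behind the common prefix, the value is at most \<open>l\<close> after the digit \<open>0\<close> and at least \<open>1 - l\<close>
  after the digit \<open>1\<close>; for \<open>l < 1/2\<close> this is the gap between the two halves of \<open>K\<^sub>l\<close>.
\<close>

lemma digit_value_gap:
  assumes l: "0 < l" "l < 1" and j: "binary_seq j" "binary_seq k"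
    and eq: "\<And>i. i < n \<Longrightarrow> j i = k i" and n: "j n = 0" "k n \<noteq> 0"
  shows "l ^ n * (1 - 2 * l) \<le> digit_value l k - digit_value l j"
proof -
  let ?J = "digit_value l (\<lambda>i. j (i + n))" and ?K = "digit_value l (\<lambda>i. k (i + n))"
  have "(\<Sum>i<n. real (j i) * l ^ i) = (\<Sum>i<n. real (k i) * l ^ i)"
    using eq by (intro sum.cong) auto
  then have "digit_value l k - digit_value l j = l ^ n * (?K - ?J)"
    using digit_value_split[OF l j(1), of n] digit_value_split[OF l j(2), of n]
    by (simp add: algebra_simps)
  moreover have "?J \<le> l" "1 - l \<le> ?K"
    using digit_value_first_digit(1)[OF l binary_seq_shift[OF j(1)], of n]
      digit_value_first_digit(2)[OF l binary_seq_shift[OF j(2)], of n] n by simp_all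
  ultimately show ?thesis using l by (simp add: mult_left_mono)
qed

text \<open>
  The weight of the \<open>n\<close>-th digit is \<open>l\<^sup>n\<^sup>-\<^sup>1 \<cdot> l (1 - l)\<close>: the first factor does not decrease, and the
  second increases by \<open>(1 - a - b) (b - a)\<close> from \<open>a\<close> to \<open>b\<close>.
\<close>

lemma geometric_term_increment:
  fixes a b :: real
  assumes "0 < a" "a \<le> b" "b \<le> 1/2" "n \<noteq> 0"
  shows "a ^ (n - 1) * (1 - a - b) * (b - a) \<le> b ^ n * (1 - b) - a ^ n * (1 - a)"
proof -
  obtain m where n: "n = Suc m" using assms(4) not0_implies_Suc by blast
  have "a ^ m * (b * (1 - b)) \<le> b ^ m * (b * (1 - b))"
    using assms by (intro mult_right_mono power_mono) auto
  then show ?thesis by (simp add: n algebra_simps)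
qed

text \<open>
  All weights with \<open>n \<noteq> 0\<close> increase with the parameter up to \<open>1/2\<close>. So the increment of the value
  lies between that of any single digit \<open>1\<close> of \<open>j\<close> and that of the sequence \<open>0111...\<close>. The latter has value
  \<open>l\<close>, which gives the Lipschitz constant \<open>1\<close>.
\<close>

lemma digit_value_increment:
  assumes ab: "0 < a" "a \<le> b" "b \<le> 1/2" and j: "binary_seq j" "j 0 = 0"
  shows "0 \<le> digit_value b j - digit_value a j"
    and "digit_value b j - digit_value a j \<le> b - a"
    and "j m \<noteq> 0 \<Longrightarrow> a ^ (m - 1) * (1 - a - b) * (b - a) \<le> digit_value b j - digit_value a j"
proof -
  define T where "T n = b ^ n * (1 - b) - a ^ n * (1 - a)" for n
  have T: "0 \<le> T n" if "n \<noteq> 0" for n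
  proof -
    have "0 \<le> a ^ (n - 1) * (1 - a - b) * (b - a)" using ab by simp
    then show ?thesis using geometric_term_increment[OF ab that] unfolding T_def by linarith
  qed
  have sums: "(\<lambda>n. real (k n) * T n) sums (digit_value b k - digit_value a k)"
    if "binary_seq k" for k
    using sums_diff[OF digit_value_sums[OF _ _ that, of b] digit_value_sums[OF _ _ that, of a]] ab
    by (simp add: T_def algebra_simps)
  have nonneg: "0 \<le> real (j n) * T n" for n using T j by (cases "n = 0") auto
  show "0 \<le> digit_value b j - digit_value a j"
    by (rule sums_le[OF _ sums_zero sums[OF j(1)]]) (rule nonneg)
  define u :: "nat \<Rightarrow> nat" where "u n = (if n = 0 then 0 else 1)" for n
  have u: "binary_seq u" by (simp add: u_def binary_seq_def)
  have du: "digit_value l u = l" if "0 < l" "l < 1" for l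
    using digit_value_split[OF that u, of 1] digit_value_all_ones[OF that] by (simp add: u_def)
  have "real (j n) * T n \<le> real (u n) * T n" for n
    using j(1)[unfolded binary_seq_def, rule_format, of n] j(2) T[of n]
    by (cases "n = 0") (auto simp: u_def)
  from sums_le[OF this sums[OF j(1)] sums[OF u]]
  show "digit_value b j - digit_value a j \<le> b - a" using du[of a] du[of b] ab by simp
  assume m: "j m \<noteq> 0"
  then have jm: "j m = 1" "m \<noteq> 0"
    using j(1)[unfolded binary_seq_def, rule_format, of m] j(2) by (auto intro: ccontr)
  have "(if n = m then T m else 0) \<le> real (j n) * T n" for n
    using nonneg[of n] jm by auto
  from sums_le[OF this sums_single sums[OF j(1)]]
  have "T m \<le> digit_value b j - digit_value a j" .
  then show "a ^ (m - 1) * (1 - a - b) * (b - a) \<le> digit_value b j - digit_value a j"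
    using geometric_term_increment[OF ab jm(2)] by (simp add: T_def)
qed

text \<open>
  A sequence without a digit \<open>1\<close> among its first \<open>M\<close> places has value at most \<open>(1/2)\<^sup>M\<close>. So a lower
  bound on the value, at whatever parameter, makes a digit \<open>1\<close> appear before \<open>M\<close>, and that digit alone
  accounts for the increment.
\<close>

lemma digit_value_increment_uniform:
  assumes ab: "0 < a" "a \<le> b" "b \<le> 1/2" and j: "binary_seq j" "j 0 = 0"
    and l: "0 < l" "l \<le> 1/2" and M: "(1/2) ^ M < digit_value l j"
  shows "a ^ M * (1 - a - b) * (b - a) \<le> digit_value b j - digit_value a j"
proof -
  have "\<exists>m<M. j m \<noteq> 0"
  proof (rule ccontr)
    assume "\<not> ?thesis"
    then have z: "(\<Sum>n<M. real (j n) * l ^ n) = 0" by simp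
    have "digit_value l j = l ^ M * digit_value l (\<lambda>n. j (n + M))"
      using digit_value_split[OF _ _ j(1), of l M] l by (simp add: z)
    also have "\<dots> \<le> l ^ M"
      using digit_value_bounds[OF _ _ binary_seq_shift[OF j(1)], of l M] l
      by (simp add: mult_left_le)
    also have "\<dots> \<le> (1/2) ^ M" using l by (intro power_mono) auto
    finally show False using M by simp
  qed
  then obtain m where m: "m < M" "j m \<noteq> 0" by blast
  have "a ^ M * ((1 - a - b) * (b - a)) \<le> a ^ (m - 1) * ((1 - a - b) * (b - a))"
    using ab m by (intro mult_right_mono power_decreasing) auto
  then show ?thesis using digit_value_increment(3)[OF ab j m(2)] by (simp add: mult_ac)
qed

lemma digit_value_intermediate:
  assumes ab: "0 < a" "a < b" "b \<le> 1/2" and j: "binary_seq j" "j 0 = 0"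
    and x: "digit_value a j < x" "x < digit_value b j"
  obtains l where "a < l" "l < b" "digit_value l j = x"
proof -
  have lip: "\<bar>digit_value u j - digit_value v j\<bar> \<le> \<bar>u - v\<bar>" if "u \<in> {a..b}" "v \<in> {a..b}" for u v
    using digit_value_increment(1,2)[OF _ _ _ j, of u v]
      digit_value_increment(1,2)[OF _ _ _ j, of v u] that ab
    by (cases "u \<le> v") auto
  have "1-lipschitz_on {a..b} (\<lambda>l. digit_value l j)"
    by (rule lipschitz_onI) (use lip in \<open>auto simp: dist_real_def\<close>)
  then have "continuous_on {a..b} (\<lambda>l. digit_value l j)"
    by (rule lipschitz_on_continuous_on)
  from IVT'[OF _ _ _ this, of x] x ab obtain l where "a \<le> l" "l \<le> b" "digit_value l j = x"
    by fastforce
  moreover from this x have "l \<noteq> a" "l \<noteq> b" by auto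
  ultimately show thesis using that by force
qed

text \<open>
  The unit interval is the attractor for the parameter \<open>1/2\<close>.
\<close>

lemma binary_expansion:
  assumes "0 \<le> y" "y \<le> 1"
  obtains j where "binary_seq j" "digit_value (1/2) j = y"
proof -
  have "is_attractor (1/2) {0..1}"
  proof -
    have "y \<in> ifs_map (1/2) 0 ` {0..1} \<union> ifs_map (1/2) 1 ` {0..1}" if "y \<in> {0..1}" for y
    proof (cases "y \<le> 1/2")
      case True then show ?thesis using that by (intro UnI1 image_eqI[of _ _ "2 * y"]) (auto simp: ifs_map_def)
    next
      case False then show ?thesis using that by (intro UnI2 image_eqI[of _ _ "2 * y - 1"]) (auto simp: ifs_map_def field_simps)
    qed
    moreover have "ifs_map (1/2) 0 ` {0..1} \<union> ifs_map (1/2) 1 ` {0..1} \<subseteq> {0..1}"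
      by (auto simp: ifs_map_def)
    ultimately have "{0..1} = ifs_map (1/2) 0 ` {0..1} \<union> ifs_map (1/2) 1 ` {0..1}"
      by blast
    then show ?thesis by (simp add: is_attractor_def)
  qed
  from attractor_eq_digit_set[OF _ _ this] have "digit_set (1/2) = {0..1}" by simp
  then have "y \<in> digit_set (1/2)" using assms by simp
  then show thesis using that by (auto simp: digit_set_def digit_value_def binary_seq_def)
qed

lemma mem_Lambda_set_iff:
  "l \<in> Lambda_set x \<longleftrightarrow> 0 < l \<and> l \<le> 1/2 \<and> (\<exists>j. binary_seq j \<and> digit_value l j = x)"
proof -
  have "digit_set l = {digit_value l j | j. binary_seq j}"
    by (simp add: digit_set_def digit_value_def binary_seq_def)
  then show ?thesis using K_set_eq_digit_set[of l] by (auto simp: Lambda_set_def)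
qed

lemma coding_starts_with_zero:
  assumes "0 < l" "l \<le> 1/2" "binary_seq j" "digit_value l j < 1/2"
  shows "j 0 = 0"
  using digit_value_first_digit(2)[of l j] assms by fastforce

lemma Lambda_set_ge:
  assumes "x < 1/2" "l \<in> Lambda_set x"
  shows "x \<le> l"
  using assms coding_starts_with_zero digit_value_first_digit(1)
  by (force simp: mem_Lambda_set_iff)

section \<open>Upper bound and nullity\<close>

text \<open>
  Let the codings of \<open>l \<le> l'\<close> agree on \<open>N\<close> digits. Moving the parameter of the first coding from \<open>l\<close> to
  \<open>l'\<close> increases its value by at least \<open>c (l' - l)\<close>. The result is within \<open>b\<^sup>N\<close> of the value
  of the second coding at \<open>l'\<close>, which is \<open>x\<close> again. Hence \<open>c (l' - l) \<le> b\<^sup>N\<close>.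
\<close>

lemma Lambda_set_geometric_cover:
  assumes x: "0 < x" "x < 1/2" and b: "0 < b" "b < 1/2"
  obtains C where "0 \<le> C" "geometric_cover (Lambda_set x \<inter> {..b}) C b"
proof -
  obtain M where M: "(1/2) ^ M < x" using real_arch_pow_inv[of x "1/2"] x by auto
  \<comment> \<open>Parameters in \<open>\<Lambda>(x)\<close> are at least \<open>x\<close>, so \<open>c\<close> bounds the speed \<open>l\<^sup>M (1 - l - l')\<close> from below.\<close>
  define c where "c = x ^ M * (1 - 2 * b)"
  have c: "0 < c" using x b by (simp add: c_def)
  \<comment> \<open>A prefix of length \<open>N\<close> is represented by the set of positions of its digits \<open>1\<close>.\<close>
  define E where "E N S = {l \<in> Lambda_set x \<inter> {..b}. \<exists>j. binary_seq j \<and> digit_value l j = x \<and>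
      {n. n < N \<and> j n = 1} = S}" for N S
  have dist: "l' - l \<le> 1 / c * b ^ N" if E: "l \<in> E N S" "l' \<in> E N S" and le: "l \<le> l'" for l l' N S
  proof -
    obtain j where j: "binary_seq j" "digit_value l j = x" "{n. n < N \<and> j n = 1} = S"
      using E(1) unfolding E_def by blast
    obtain k where k: "binary_seq k" "digit_value l' k = x" "{n. n < N \<and> k n = 1} = S"
      using E(2) unfolding E_def by blast
    have "x \<le> l" "l' \<le> b" using E Lambda_set_ge[OF x(2)] by (auto simp: E_def)
    then have l: "0 < l" "x \<le> l" "l' \<le> b" using x by linarith+
    have j0: "j 0 = 0" by (rule coding_starts_with_zero[of l j]) (use j l le b x in auto)
    have "j n = k n" if "n < N" for n
    proof -
      have "j n = 1 \<longleftrightarrow> k n = 1" using j(3) k(3) that by blast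
      moreover have "j n \<in> {0, 1}" "k n \<in> {0, 1}" using j(1) k(1) by (simp_all add: binary_seq_def)
      ultimately show ?thesis by auto
    qed
    then have "\<bar>digit_value l' j - digit_value l' k\<bar> \<le> l' ^ N"
      by (intro digit_value_agree j k) (use l le b in auto)
    also have "\<dots> \<le> b ^ N" using l le by (intro power_mono) auto
    finally have "digit_value l' j - digit_value l j \<le> b ^ N" using j k by simp
    moreover have "l ^ M * (1 - l - l') * (l' - l) \<le> digit_value l' j - digit_value l j"
      by (rule digit_value_increment_uniform[of _ _ _ l]) (use l le b j j0 M in auto)
    moreover have "c * (l' - l) \<le> l ^ M * (1 - l - l') * (l' - l)"
      unfolding c_def using l le x b by (intro mult_right_mono mult_mono power_mono) auto
    ultimately show ?thesis using c by (simp add: field_simps)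
  qed
  have "geometric_cover (Lambda_set x \<inter> {..b}) (1 / c) b"
  proof (rule geometric_coverI)
    fix N
    let ?\<U> = "E N ` Pow {..<N}"
    show "finite ?\<U>" by (intro finite_imageI) simp
    show "card ?\<U> \<le> 2 ^ N" using card_image_le[of "Pow {..<N}" "E N"] by (simp add: card_Pow)
    show "Lambda_set x \<inter> {..b} \<subseteq> \<Union>?\<U>"
    proof
      fix l assume l: "l \<in> Lambda_set x \<inter> {..b}"
      then obtain j where "binary_seq j" "digit_value l j = x" by (auto simp: mem_Lambda_set_iff)
      then have mem: "l \<in> E N {n. n < N \<and> j n = 1}" using l by (auto simp: E_def)
      have "{n. n < N \<and> j n = 1} \<in> Pow {..<N}" by auto
      then have "E N {n. n < N \<and> j n = 1} \<in> ?\<U>" by (rule imageI[of _ _ "E N"])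
      then show "l \<in> \<Union>?\<U>" using mem by (rule UnionI)
    qed
    fix U assume "U \<in> ?\<U>"
    then obtain S where U: "U = E N S" by (rule imageE)
    have "U \<subseteq> {0..1}" by (auto simp: U E_def mem_Lambda_set_iff)
    then show "bounded U" by (rule bounded_subset[OF bounded_closed_interval])
    have "norm (u - v) \<le> 1 / c * b ^ N" if "u \<in> U" "v \<in> U" for u v
      using dist[of u N S v] dist[of v N S u] that unfolding U by (cases "u \<le> v") auto
    then show "diameter U \<le> 1 / c * b ^ N" using b c by (intro diameter_le) auto
  qed
  then show thesis using that[of "1 / c"] c by simp
qed

lemma unit_interval_geometric_cover: "geometric_cover {0..1::real} 1 (1/2)"
proof (rule geometric_coverI)
  fix N
  define I where "I k = {real k / 2 ^ N .. (real k + 1) / 2 ^ N}" for k :: nat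
  let ?\<U> = "(\<lambda>k. {real k / 2 ^ N .. (real k + 1) / 2 ^ N}) ` {..<2 ^ N}"
  have I: "?\<U> = I ` {..<2 ^ N}" by (simp add: I_def)
  show "finite ?\<U>" by (intro finite_imageI) simp
  show "card ?\<U> \<le> 2 ^ N" unfolding I using card_image_le[of "{..<2 ^ N :: nat}" I] by simp
  show "{0..1} \<subseteq> \<Union>?\<U>"
  proof
    fix y :: real assume y: "y \<in> {0..1}"
    have "\<exists>k<2 ^ N. y \<in> I k"
    proof (cases "y = 1")
      case True
      have "real (2 ^ N - 1) = 2 ^ N - 1" by (simp add: of_nat_diff)
      then have "y \<in> I (2 ^ N - 1)" using True by (simp add: I_def)
      then show ?thesis by (intro exI[of _ "2 ^ N - 1"]) simp
    next
      case False
      define k where "k = nat \<lfloor>y * 2 ^ N\<rfloor>"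
      have "real k \<le> y * 2 ^ N" "y * 2 ^ N < real k + 1" using y by (auto simp: k_def)
      moreover from this False y have "real k < 2 ^ N"
        by (smt (verit) atLeastAtMost_iff mult_less_cancel_right2 zero_less_power)
      then have "k < 2 ^ N" by (metis of_nat_less_iff of_nat_numeral of_nat_power)
      ultimately show ?thesis by (intro exI[of _ k]) (auto simp: I_def field_simps)
    qed
    then obtain k where "k < 2 ^ N" "y \<in> I k" by blast
    then show "y \<in> \<Union>?\<U>" unfolding I by blast
  qed
  fix U assume U: "U \<in> ?\<U>"
  show "bounded U" using U by auto
  show "diameter U \<le> 1 * (1/2) ^ N" using U by (auto simp: diameter_closed_interval field_simps)
qed

lemma hausdorff_dim_Lambda_set_le:
  assumes x: "0 < x" "x < 1/2" and b: "0 < b" "b \<le> 1/2"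
  shows "hausdorff_dim (Lambda_set x \<inter> {..b}) \<le> ereal (ln 2 / - ln b)"
proof (cases "b = 1/2")
  case True
  have "hausdorff_dim (Lambda_set x \<inter> {..b}) \<le> hausdorff_dim {0..1::real}"
    by (rule hausdorff_dim_mono) (auto simp: mem_Lambda_set_iff)
  also have "\<dots> \<le> ereal (ln 2 / - ln (1/2))"
    by (rule hausdorff_dim_le_if_geometric_cover[OF _ _ _ unit_interval_geometric_cover]) auto
  finally show ?thesis by (simp only: True)
next
  case False
  then have b': "b < 1/2" using b by simp
  obtain C where C: "0 \<le> C" "geometric_cover (Lambda_set x \<inter> {..b}) C b"
    using Lambda_set_geometric_cover[OF x b(1) b'] by blast
  show ?thesis by (rule hausdorff_dim_le_if_geometric_cover[OF b(1) _ C]) (use b in auto)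
qed

lemma Lambda_set_null:
  assumes x: "0 < x" "x < 1/2"
  shows "Lambda_set x \<in> null_sets lebesgue"
proof -
  \<comment> \<open>The shift by \<open>3\<close> keeps \<open>b n\<close> positive.\<close>
  define b where "b n = 1/2 - 1 / (real n + 3)" for n
  have b: "0 < b n" "b n < 1/2" for n by (auto simp: b_def field_simps)
  have "Lambda_set x \<inter> {..b n} \<in> null_sets lebesgue" for n
  proof -
    have "ln 2 < - ln (b n)" using b[of n] ln_less_cancel_iff[of "b n" "1/2"] by (simp add: ln_div)
    then have 1: "ln 2 / - ln (b n) < 1" using b[of n] by (subst pos_divide_less_eq) auto
    obtain C where C: "0 \<le> C" "geometric_cover (Lambda_set x \<inter> {..b n}) C (b n)"
      using Lambda_set_geometric_cover[OF x b] by blast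
    have "hausdorff_measure 1 (Lambda_set x \<inter> {..b n}) = 0"
      by (rule hausdorff_measure_eq_0_if_geometric_cover[OF b(1) _ C(1) 1 C(2)]) (use b[of n] in auto)
    from Hoelder_image_null[OF _ _ this, of 1 "\<lambda>l. l"] show ?thesis by (simp add: dist_real_def)
  qed
  then have "(\<Union>n. Lambda_set x \<inter> {..b n}) \<in> null_sets lebesgue" by (rule null_sets_UN)
  moreover have "{1/2::real} \<in> null_sets lebesgue"
    by (simp flip: negligible_iff_null_sets)
  ultimately have N: "(\<Union>n. Lambda_set x \<inter> {..b n}) \<union> {1/2} \<in> null_sets lebesgue" by blast
  have "Lambda_set x \<subseteq> (\<Union>n. Lambda_set x \<inter> {..b n}) \<union> {1/2}"
  proof
    fix l assume l: "l \<in> Lambda_set x"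
    show "l \<in> (\<Union>n. Lambda_set x \<inter> {..b n}) \<union> {1/2}"
    proof (cases "l = 1/2")
      case False
      then have "0 < 1/2 - l" using l by (auto simp: mem_Lambda_set_iff)
      from reals_Archimedean[OF this] obtain n where "1 / (real n + 1) < 1/2 - l"
        by (auto simp: inverse_eq_divide add.commute)
      moreover have "1 / (real n + 3) \<le> 1 / (real n + 1)" by (simp add: frac_le)
      ultimately have "l \<le> b n" by (simp add: b_def)
      then show ?thesis using l by auto
    qed simp
  qed
  then show ?thesis using N by (metis negligible_iff_null_sets negligible_subset)
qed

section \<open>Lower bound for the dimension\<close>

text \<open>
  At the parameter \<open>l\<close> the two codings have values at least \<open>l\<^sup>n (1 - 2 l)\<close> apart. One value is
  \<open>x\<close>; the other becomes \<open>x\<close> when the parameter moves to \<open>l'\<close>, and the Lipschitz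
  bound says that it moves by at most \<open>\<bar>l - l'\<bar>\<close>.
\<close>

lemma coding_separation:
  assumes x: "x < 1/2" and a: "0 < a" and b: "b < 1/2"
    and l: "l \<in> {a..b}" "l' \<in> {a..b}"
    and j: "binary_seq j" "digit_value l j = x" and k: "binary_seq k" "digit_value l' k = x"
    and n: "\<And>i. i < n \<Longrightarrow> j i = k i" "j n \<noteq> k n"
  shows "a ^ n * (1 - 2 * b) \<le> \<bar>l - l'\<bar>"
proof -
  have main: "a ^ n * (1 - 2 * b) \<le> \<bar>l - l'\<bar>"
    if l: "l \<in> {a..b}" "l' \<in> {a..b}"
    and j: "binary_seq j" "digit_value l j = x" and k: "binary_seq k" "digit_value l' k = x"
    and n: "\<And>i. i < n \<Longrightarrow> j i = k i" "j n = 0" "k n \<noteq> 0" for l l' j k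
  proof -
    have k0: "k 0 = 0" by (rule coding_starts_with_zero[of l' k]) (use k l a b x in auto)
    have "a ^ n * (1 - 2 * b) \<le> l ^ n * (1 - 2 * l)"
      using a b l by (intro mult_mono[OF power_mono]) auto
    also have "\<dots> \<le> digit_value l k - digit_value l j"
      by (rule digit_value_gap) (use a b l j k n in auto)
    also have "\<dots> = digit_value l k - digit_value l' k" using j k by simp
    also have "\<dots> \<le> \<bar>l - l'\<bar>"
      using digit_value_increment(1,2)[OF _ _ _ k(1) k0, of l l']
        digit_value_increment(1,2)[OF _ _ _ k(1) k0, of l' l] a b l
      by (cases "l \<le> l'") auto
    finally show ?thesis .
  qed
  have "j n = 0 \<and> k n \<noteq> 0 \<or> k n = 0 \<and> j n \<noteq> 0"
    using n(2) j(1)[unfolded binary_seq_def, rule_format, of n]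
      k(1)[unfolded binary_seq_def, rule_format, of n] by auto
  then show ?thesis
    using main[OF l j k n(1)] main[OF l(2,1) k j n(1)[symmetric]] by (auto simp: abs_minus_commute)
qed

lemma first_difference:
  fixes j k :: "nat \<Rightarrow> 'a"
  assumes "j \<noteq> k"
  obtains n where "\<And>i. i < n \<Longrightarrow> j i = k i" "j n \<noteq> k n"
proof -
  have "\<exists>n. j n \<noteq> k n" using assms by blast
  then show thesis
    using that[of "LEAST n. j n \<noteq> k n"] LeastI_ex[of "\<lambda>n. j n \<noteq> k n"]
      not_less_Least[of _ "\<lambda>n. j n \<noteq> k n"] by blast
qed

lemma coding_unique:
  assumes x: "x < 1/2" and l: "0 < l" "l < 1/2"
    and j: "binary_seq j" "digit_value l j = x" and k: "binary_seq k" "digit_value l k = x"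
  shows "j = k"
proof (rule ccontr)
  assume "j \<noteq> k"
  then obtain n where "\<And>i. i < n \<Longrightarrow> j i = k i" "j n \<noteq> k n" by (rule first_difference) blast
  from coding_separation[OF x l _ _ j k this] have "l ^ n * (1 - 2 * l) \<le> 0" by simp
  moreover have "0 < l ^ n * (1 - 2 * l)" using l by simp
  ultimately show False by linarith
qed

text \<open>
  The map that sends a parameter to its coding, read as a binary expansion, is Hoelder continuous:
  if two codings first differ at place \<open>n\<close>, then the images are at most \<open>(1/2)\<^sup>n\<close> apart, the parameters are at least \<open>(1 - 2 b) a\<^sup>n\<close>
  apart, and \<open>(a\<^sup>n)\<^sup>s = (1/2)\<^sup>n\<close>. The image contains all
  binary numbers that start with a sufficiently long prefix of the coding at \<open>l\<close>.
\<close>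

lemma hausdorff_dim_Lambda_set_ge_below_half:
  assumes x: "0 < x" "x < 1/2" and l: "l \<in> Lambda_set x" and a: "0 < a" "a < l"
    and b: "l < b" "b < 1/2"
  shows "ereal (ln 2 / - ln a) \<le> hausdorff_dim (Lambda_set x \<inter> {a<..<b})"
proof (rule hausdorff_dim_ge, rule notI)
  let ?A = "Lambda_set x \<inter> {a<..<b}"
  define s where "s = ln 2 / - ln a"
  assume "hausdorff_measure (ln 2 / - ln a) ?A = 0"
  then have null: "hausdorff_measure s ?A = 0" by (simp add: s_def)
  have s: "0 < s" unfolding s_def using a b by (intro divide_pos_pos) auto
  have "a powr s = 1/2" using a b by (simp add: s_def powr_def exp_minus)
  then have half_pow: "(a ^ n) powr s = (1/2) ^ n" for n
    using a by (induction n) (simp_all add: powr_mult)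
  define code where "code u = (SOME j. binary_seq j \<and> digit_value u j = x)" for u
  define h where "h u = digit_value (1/2) (code u)" for u
  have code: "binary_seq (code u)" "digit_value u (code u) = x" if "u \<in> ?A" for u
  proof -
    have "\<exists>j. binary_seq j \<and> digit_value u j = x" using that by (simp add: mem_Lambda_set_iff)
    from someI_ex[OF this] show "binary_seq (code u)" "digit_value u (code u) = x"
      by (simp_all add: code_def)
  qed
  define C where "C = (1 / (1 - 2 * b)) powr s"
  have hoelder: "\<bar>h u - h v\<bar> \<le> C * dist u v powr s" if uv: "u \<in> ?A" "v \<in> ?A" for u v
  proof (cases "code u = code v")
    case True then show ?thesis by (simp add: h_def C_def)
  next
    case False
    then obtain n where n: "\<And>i. i < n \<Longrightarrow> code u i = code v i" "code u n \<noteq> code v n"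
      by (rule first_difference) blast
    have "a ^ n * (1 - 2 * b) \<le> \<bar>u - v\<bar>"
      by (rule coding_separation[OF x(2) a(1) b(2) _ _ code[OF uv(1)] code[OF uv(2)] n])
         (use uv in auto)
    then have "a ^ n \<le> 1 / (1 - 2 * b) * \<bar>u - v\<bar>" using b by (simp add: field_simps)
    then have "(a ^ n) powr s \<le> (1 / (1 - 2 * b) * \<bar>u - v\<bar>) powr s"
      using s a by (intro powr_mono2) auto
    also have "\<dots> = C * dist u v powr s" unfolding C_def dist_real_def
      by (rule powr_mult)
    finally have "(1/2) ^ n \<le> C * dist u v powr s" by (simp only: half_pow)
    moreover have "\<bar>h u - h v\<bar> \<le> (1/2) ^ n" unfolding h_def
      by (rule digit_value_agree) (use code uv n in auto)
    ultimately show ?thesis by linarith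
  qed
  have image: "h ` ?A \<in> null_sets lebesgue"
    by (rule Hoelder_image_null[OF s _ null hoelder]) (simp_all add: C_def)
  obtain i where i: "binary_seq i" "digit_value l i = x" using l by (auto simp: mem_Lambda_set_iff)
  have i0: "i 0 = 0" by (rule coding_starts_with_zero[of l i]) (use i a b x in auto)
  obtain M where M: "(1/2) ^ M < x" using real_arch_pow_inv[of x "1/2"] x by auto
  have inc: "digit_value u i < digit_value v i" if "0 < u" "u < v" "v \<le> b" for u v
  proof -
    have "0 < u ^ M * (1 - u - v) * (v - u)" using that b by simp
    also have "\<dots> \<le> digit_value v i - digit_value u i"
      by (rule digit_value_increment_uniform[OF _ _ _ i(1) i0, of _ _ l]) (use that a b i M in auto)
    finally show ?thesis by simp
  qed
  \<comment> \<open>Sequences whose values at \<open>a\<close> and \<open>b\<close> differ from those of \<open>i\<close> by less than \<open>e\<close>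
    still take the value \<open>x\<close> strictly between \<open>a\<close> and \<open>b\<close>.\<close>
  define e where "e = min (x - digit_value a i) (digit_value b i - x)"
  have "0 < e" using inc[of a l] inc[of l b] a b i by (simp add: e_def)
  then obtain N0 where N0: "(1/2) ^ N0 < e" using real_arch_pow_inv[of e "1/2"] by auto
  \<comment> \<open>The prefix must not be empty, as it has to fix the first digit \<open>0\<close>.\<close>
  define N where "N = Suc N0"
  have N: "(1/2) ^ N < e" using N0 zero_le_power[of "1/2::real" N0] unfolding N_def power_Suc by linarith
  \<comment> \<open>The division by \<open>2\<close> is the factor \<open>1 - l\<close> at \<open>l = 1/2\<close>.\<close>
  define P where "P = (\<Sum>n<N. real (i n) * (1/2) ^ n) / 2"
  have "{P..P + (1/2) ^ N} \<subseteq> h ` ?A"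
  proof
    fix z assume z: "z \<in> {P..P + (1/2) ^ N}"
    define y where "y = (z - P) * 2 ^ N"
    have y: "0 \<le> y" "y \<le> 1" using z by (auto simp: y_def field_simps power_divide)
    then obtain k where k: "binary_seq k" "digit_value (1/2) k = y" by (rule binary_expansion)
    define j where "j n = (if n < N then i n else k (n - N))" for n
    have j: "binary_seq j" using i k by (simp add: j_def binary_seq_def)
    have j0: "j 0 = 0" using i0 by (simp add: j_def N_def)
    have "(\<lambda>n. j (n + N)) = k" by (simp add: j_def)
    then have "digit_value (1/2) j = P + (1/2) ^ N * y"
      using digit_value_split[OF _ _ j, of "1/2" N] k by (simp add: P_def j_def)
    also have "\<dots> = z" by (simp add: y_def power_divide)
    finally have jz: "digit_value (1/2) j = z" .
    have close: "\<bar>digit_value u j - digit_value u i\<bar> < e" if "0 < u" "u < 1/2" for u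
    proof -
      have "\<bar>digit_value u j - digit_value u i\<bar> \<le> u ^ N"
        by (rule digit_value_agree) (use that i j in \<open>auto simp: j_def\<close>)
      also have "\<dots> \<le> (1/2) ^ N" using that by (intro power_mono) auto
      finally show ?thesis using N by linarith
    qed
    have "digit_value a j < x" "x < digit_value b j"
      using close[of a] close[of b] a b by (auto simp: e_def)
    then obtain u where u: "a < u" "u < b" "digit_value u j = x"
      using digit_value_intermediate[OF a(1) _ _ j j0, of b x] a b by auto
    then have uA: "u \<in> ?A" using a b j by (auto simp: mem_Lambda_set_iff)
    have "code u = j"
      by (rule coding_unique[OF x(2) _ _ code[OF uA] j u(3)]) (use u a b in auto)
    then have "z = h u" using jz by (simp add: h_def)
    then show "z \<in> h ` ?A" using uA by blast
  qed
  then have "negligible {P..P + (1/2) ^ N}"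
    using image negligible_subset unfolding negligible_iff_null_sets[symmetric] by blast
  then have "negligible (cbox P (P + (1/2) ^ N))" by (simp only: cbox_interval)
  then have "(1/2::real) ^ N \<le> 0" unfolding negligible_interval by simp
  moreover have "(0::real) < (1/2) ^ N" by (rule zero_less_power) simp
  ultimately show False by linarith
qed

text \<open>
  A binary expansion \<open>j\<close> of a number \<open>y\<close> slightly above \<open>x\<close> has value above \<open>x\<close> at \<open>1/2\<close>. Going down
  to \<open>a\<close> lowers the value by at least \<open>e\<close>, a bound that does not depend on \<open>y\<close>. If \<open>y < x + e\<close>, the value \<open>x\<close>
  is passed on the way.
\<close>

lemma Lambda_set_accumulates_at_half:
  assumes x: "0 < x" "x < 1/2" and a: "0 < a" "a < 1/2"
  obtains l where "l \<in> Lambda_set x" "a < l" "l < 1/2"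
proof -
  obtain M where M: "(1/2) ^ M < x" using real_arch_pow_inv[of x "1/2"] x by auto
  define e where "e = a ^ M * (1 - a - 1/2) * (1/2 - a)"
  have e: "0 < e" using a by (simp add: e_def)
  define y where "y = min (x + e / 2) ((x + 1/2) / 2)"
  have y: "x < y" "y < 1/2" "y < x + e" using x e unfolding y_def min_def by (auto simp: field_simps)
  obtain j where j: "binary_seq j" "digit_value (1/2) j = y"
    using binary_expansion[of y] x y by auto
  have j0: "j 0 = 0" by (rule coding_starts_with_zero[of "1/2" j]) (use j y in auto)
  have "e \<le> digit_value (1/2) j - digit_value a j" unfolding e_def
    by (rule digit_value_increment_uniform[OF _ _ _ j(1) j0, of _ _ "1/2"]) (use a j y M in auto)
  then obtain l where l: "a < l" "l < 1/2" "digit_value l j = x"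
    using digit_value_intermediate[OF a _ j(1) j0, of x] j y by auto
  then show thesis using that a j by (auto simp: mem_Lambda_set_iff)
qed

text \<open>
  At \<open>l = 1/2\<close> the separation of codings breaks down; another member of \<open>\<Lambda>(x)\<close> between \<open>a\<close> and
  \<open>1/2\<close> then takes over the role of \<open>l\<close>.
\<close>

lemma hausdorff_dim_Lambda_set_ge:
  assumes x: "0 < x" "x < 1/2" and l: "l \<in> Lambda_set x" and a: "0 < a" "a < l" and c: "l < c"
  shows "ereal (ln 2 / - ln a) \<le> hausdorff_dim (Lambda_set x \<inter> {a<..<c})"
proof -
  obtain l' where l': "l' \<in> Lambda_set x" "a < l'" "l' < 1/2" "l' < c"
  proof (cases "l = 1/2")
    case True
    then show thesis using Lambda_set_accumulates_at_half[OF x a(1)] a c that by force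
  next
    case False
    then show thesis using l a c that[of l] by (auto simp: mem_Lambda_set_iff)
  qed
  define b where "b = (l' + min c (1/2)) / 2"
  have b: "l' < b" "b < 1/2" "b < c" using l' by (auto simp: b_def min_def)
  have "ereal (ln 2 / - ln a) \<le> hausdorff_dim (Lambda_set x \<inter> {a<..<b})"
    by (rule hausdorff_dim_Lambda_set_ge_below_half[OF x l'(1) a(1) l'(2) b(1,2)])
  also have "\<dots> \<le> hausdorff_dim (Lambda_set x \<inter> {a<..<c})"
    by (rule hausdorff_dim_mono) (use b in auto)
  finally show ?thesis .
qed

section \<open>The local dimension\<close>

theorem theorem1p2:
  fixes x :: real
  assumes "0 < x" and "x < 1/2"
  shows "Lambda_set x \<in> null_sets lebesgue
       \<and> hausdorff_dim (Lambda_set x) = 1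
       \<and> (\<forall>l \<in> Lambda_set x.
            ((\<lambda>\<delta>. hausdorff_dim (Lambda_set x \<inter> {l - \<delta> <..< l + \<delta>}))
               \<longlongrightarrow> ereal (ln 2 / (- ln l))) (at_right 0))"
proof (intro conjI ballI)
  show "Lambda_set x \<in> null_sets lebesgue" by (rule Lambda_set_null[OF assms])
  show limit: "((\<lambda>\<delta>. hausdorff_dim (Lambda_set x \<inter> {l - \<delta> <..< l + \<delta>}))
      \<longlongrightarrow> ereal (ln 2 / (- ln l))) (at_right 0)" if l: "l \<in> Lambda_set x" for l
  proof (rule tendsto_sandwich)
    have l2: "0 < l" "l \<le> 1/2" using l by (auto simp: mem_Lambda_set_iff)
    have small: "\<forall>\<^sub>F \<delta> in at_right 0. \<delta> \<in> {0<..<l}"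
      by (rule eventually_at_right_real[OF l2(1)])
    show "\<forall>\<^sub>F \<delta> in at_right 0. ereal (ln 2 / - ln (l - \<delta>))
        \<le> hausdorff_dim (Lambda_set x \<inter> {l - \<delta> <..< l + \<delta>})"
      using small
    proof eventually_elim
      case (elim \<delta>)
      then show ?case by (intro hausdorff_dim_Lambda_set_ge[OF assms l]) auto
    qed
    show "\<forall>\<^sub>F \<delta> in at_right 0. hausdorff_dim (Lambda_set x \<inter> {l - \<delta> <..< l + \<delta>})
        \<le> ereal (ln 2 / - ln (min (l + \<delta>) (1/2)))"
      using small
    proof eventually_elim
      case (elim \<delta>)
      have "hausdorff_dim (Lambda_set x \<inter> {l - \<delta> <..< l + \<delta>})
          \<le> hausdorff_dim (Lambda_set x \<inter> {..min (l + \<delta>) (1/2)})"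
        by (rule hausdorff_dim_mono) (auto simp: mem_Lambda_set_iff)
      also have "\<dots> \<le> ereal (ln 2 / - ln (min (l + \<delta>) (1/2)))"
        by (rule hausdorff_dim_Lambda_set_le[OF assms _ min.cobounded2]) (use elim l2 in simp)
      finally show ?case .
    qed
    have ln: "- ln l \<noteq> 0" using l2 by simp
    have "((\<lambda>\<delta>. ln 2 / - ln (l - \<delta>)) \<longlongrightarrow> ln 2 / - ln (l - 0)) (at_right 0)"
      by (intro tendsto_intros) (use l2 ln in auto)
    then show "((\<lambda>\<delta>. ereal (ln 2 / - ln (l - \<delta>))) \<longlongrightarrow> ereal (ln 2 / - ln l)) (at_right 0)"
      by simp
    have "min (l + 0) (1/2) = l" using l2 by simp
    then have "((\<lambda>\<delta>. ln 2 / - ln (min (l + \<delta>) (1/2))) \<longlongrightarrow> ln 2 / - ln (min (l + 0) (1/2))) (at_right 0)"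
      by (intro tendsto_intros) (use l2 ln in auto)
    then show "((\<lambda>\<delta>. ereal (ln 2 / - ln (min (l + \<delta>) (1/2)))) \<longlongrightarrow> ereal (ln 2 / - ln l)) (at_right 0)"
      using \<open>min (l + 0) (1/2) = l\<close> by simp
  qed
  show "hausdorff_dim (Lambda_set x) = 1"
  proof (rule antisym)
    have half: "ln 2 / - ln (1/2) = (1::real)" by (simp add: ln_div)
    have "Lambda_set x \<inter> {..1/2} = Lambda_set x" by (auto simp: mem_Lambda_set_iff)
    then show "hausdorff_dim (Lambda_set x) \<le> 1"
      using hausdorff_dim_Lambda_set_le[OF assms, of "1/2"] half by (simp add: one_ereal_def)
    have "1/2 \<in> Lambda_set x"
      using binary_expansion[of x] assms by (auto simp: mem_Lambda_set_iff)
    from limit[OF this] half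
    have lim: "((\<lambda>\<delta>. hausdorff_dim (Lambda_set x \<inter> {1/2 - \<delta> <..< 1/2 + \<delta>})) \<longlongrightarrow> 1) (at_right 0)"
      by (simp add: one_ereal_def)
    show "1 \<le> hausdorff_dim (Lambda_set x)"
      by (rule tendsto_upperbound[OF lim]) (auto intro!: always_eventually hausdorff_dim_mono)
  qed
qed

end
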